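(* Let $M$ be an ordered $\Gamma$-groupoid and let $\mu : M \to [0,1]$ be a fuzzy subset of $M$. (i) If $\mu$ is a fuzzy ideal of $M$ and $t\in[0,1]$ is such that $\mu_t \neq \emptyset$, then $\mu_t$ is an ideal of $M$. (ii) Conversely, if $\mu_t$ is an ideal of $M$ for every $t\in[0,1]$, then $\mu$ is a fuzzy ideal of $M$.
   Context: Let $M,\Gamma$ be nonempty sets. $M$ is a $\Gamma$-groupoid if there is a well-defined operation $M\times\Gamma\times M\to M$, $(a,\gamma,b)\mapsto a\gamma b$ (no associativity assumed). An ordered $\Gamma$-groupoid is a $\Gamma$-groupoid $M$ with a partial order $\le$ on $M$ such that $a\le b$ implies $a\gamma c\le b\gamma c$ and $c\gamma a\le c\gamma b$ for all $c\in M$, $\gamma\in\Gamma$. A nonempty subset $A\subseteq M$ is a left (resp. right) ideal of $M$ if (1) $x\gamma a\in A$ (resp. $a\gamma x\in A$) for all $x\in M,\gamma\in\Gamma,a\in A$, and (2) $a\in A$, $b\in M$, $b\le a$ imply $b\in A$. It is an ideal if it is both a left and a right ideal. (In particular ideals are nonempty by definition.) A fuzzy subset of $M$ is any mapping $\mu:M\to[0,1]$. It is a fuzzy left (resp. right) ideal of $M$ if (1) $\mu(x\gamma y)\ge\mu(y)$ (resp. $\mu(x\gamma y)\ge\mu(x)$) for all $x,y\in M$, $\gamma\in\Gamma$, and (2) $x\le y$ implies $\mu(x)\ge\mu(y)$. It is a fuzzy ideal if it is both a fuzzy left and a fuzzy right ideal. For $t\in[0,1]$, the level subset is $\mu_t:=\{x\in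 M\mid \mu(x)\ge t\}$. *)

theory Defs
  imports Complex_Main "HOL-Library.FuncSet"
begin

(* M and G are explicit carrier sets; "opn a g b" is the product a g b, and
   "(a, b) \<in> r" means a \<le> b.  No associativity is assumed. *)

locale gamma_groupoid =
  fixes M :: "'a set" and G :: "'g set" and opn :: "'a \<Rightarrow> 'g \<Rightarrow> 'a \<Rightarrow> 'a"
  assumes carrier_nonempty: "M \<noteq> {}"
    and Gamma_nonempty: "G \<noteq> {}"
    and op_closed: "\<lbrakk>a \<in> M; g \<in> G; b \<in> M\<rbrakk> \<Longrightarrow> opn a g b \<in> M"

locale ordered_gamma_groupoid = gamma_groupoid M G opn
  for M :: "'a set" and G :: "'g set" and opn :: "'a \<Rightarrow> 'g \<Rightarrow> 'a \<Rightarrow> 'a" +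
  fixes r :: "'a rel"
  assumes partial_order: "partial_order_on M r"
    and compat_right: "\<lbrakk>(a, b) \<in> r; g \<in> G; c \<in> M\<rbrakk> \<Longrightarrow> (opn a g c, opn b g c) \<in> r"
    and compat_left: "\<lbrakk>(a, b) \<in> r; g \<in> G; c \<in> M\<rbrakk> \<Longrightarrow> (opn c g a, opn c g b) \<in> r"

definition left_ideal ::
    "'a set \<Rightarrow> 'g set \<Rightarrow> ('a \<Rightarrow> 'g \<Rightarrow> 'a \<Rightarrow> 'a) \<Rightarrow> 'a rel \<Rightarrow> 'a set \<Rightarrow> bool" where
  "left_ideal M G opn r A \<longleftrightarrow>
     A \<noteq> {} \<and> A \<subseteq> M \<and>
     (\<forall>x\<in>M. \<forall>g\<in>G. \<forall>a\<in>A. opn x g a \<in> A) \<and>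
     (\<forall>a\<in>A. \<forall>b\<in>M. (b, a) \<in> r \<longrightarrow> b \<in> A)"

definition right_ideal ::
    "'a set \<Rightarrow> 'g set \<Rightarrow> ('a \<Rightarrow> 'g \<Rightarrow> 'a \<Rightarrow> 'a) \<Rightarrow> 'a rel \<Rightarrow> 'a set \<Rightarrow> bool" where
  "right_ideal M G opn r A \<longleftrightarrow>
     A \<noteq> {} \<and> A \<subseteq> M \<and>
     (\<forall>x\<in>M. \<forall>g\<in>G. \<forall>a\<in>A. opn a g x \<in> A) \<and>
     (\<forall>a\<in>A. \<forall>b\<in>M. (b, a) \<in> r \<longrightarrow> b \<in> A)"

definition gamma_ideal ::
    "'a set \<Rightarrow> 'g set \<Rightarrow> ('a \<Rightarrow> 'g \<Rightarrow> 'a \<Rightarrow> 'a) \<Rightarrow> 'a rel \<Rightarrow> 'a set \<Rightarrow> bool" where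
  "gamma_ideal M G opn r A \<longleftrightarrow> left_ideal M G opn r A \<and> right_ideal M G opn r A"

(* The values of mu outside the carrier M are irrelevant. *)

definition fuzzy_subset :: "'a set \<Rightarrow> ('a \<Rightarrow> real) \<Rightarrow> bool" where
  "fuzzy_subset M mu \<longleftrightarrow> mu \<in> M \<rightarrow> {0..1}"

definition fuzzy_left_ideal ::
    "'a set \<Rightarrow> 'g set \<Rightarrow> ('a \<Rightarrow> 'g \<Rightarrow> 'a \<Rightarrow> 'a) \<Rightarrow> 'a rel \<Rightarrow> ('a \<Rightarrow> real) \<Rightarrow> bool" where
  "fuzzy_left_ideal M G opn r mu \<longleftrightarrow>
     fuzzy_subset M mu \<and>
     (\<forall>x\<in>M. \<forall>y\<in>M. \<forall>g\<in>G. mu (opn x g y) \<ge> mu y) \<and>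
     (\<forall>x\<in>M. \<forall>y\<in>M. (x, y) \<in> r \<longrightarrow> mu x \<ge> mu y)"

definition fuzzy_right_ideal ::
    "'a set \<Rightarrow> 'g set \<Rightarrow> ('a \<Rightarrow> 'g \<Rightarrow> 'a \<Rightarrow> 'a) \<Rightarrow> 'a rel \<Rightarrow> ('a \<Rightarrow> real) \<Rightarrow> bool" where
  "fuzzy_right_ideal M G opn r mu \<longleftrightarrow>
     fuzzy_subset M mu \<and>
     (\<forall>x\<in>M. \<forall>y\<in>M. \<forall>g\<in>G. mu (opn x g y) \<ge> mu x) \<and>
     (\<forall>x\<in>M. \<forall>y\<in>M. (x, y) \<in> r \<longrightarrow> mu x \<ge> mu y)"

definition fuzzy_ideal ::
    "'a set \<Rightarrow> 'g set \<Rightarrow> ('a \<Rightarrow> 'g \<Rightarrow> 'a \<Rightarrow> 'a) \<Rightarrow> 'a rel \<Rightarrow> ('a \<Rightarrow> real) \<Rightarrow> bool" where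
  "fuzzy_ideal M G opn r mu \<longleftrightarrow> fuzzy_left_ideal M G opn r mu \<and> fuzzy_right_ideal M G opn r mu"

definition level_subset :: "'a set \<Rightarrow> ('a \<Rightarrow> real) \<Rightarrow> real \<Rightarrow> 'a set" where
  "level_subset M mu t = {x \<in> M. mu x \<ge> t}"

end

theory Submission
  imports Defs
begin

text \<open>For \<open>y\<close>, \<open>z\<close> in \<open>M\<close>,
  \<open>mu y \<le> mu z\<close> holds iff every level subset containing \<open>y\<close> also
  contains \<open>z\<close>, so the fuzzy inequalities are the ideal closure conditions read at all
  thresholds at once. \<open>fuzzy_ideal_level_subset\<close> chains
  \<open>t \<le> mu y \<le> mu z\<close>; \<open>fuzzy_ideal_if_level_subsets\<close> tests the
  single threshold \<open>mu y\<close>.\<close>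

lemma fuzzy_ideal_level_subset:
  assumes "gamma_groupoid M G opn" and "fuzzy_ideal M G opn r mu"
    and "level_subset M mu t \<noteq> {}"
  shows "gamma_ideal M G opn r (level_subset M mu t)"
  \<comment> \<open>Level subsets are cut out of \<open>M\<close>, so products must also be known to
    stay in the carrier.\<close>
  using assms gamma_groupoid.op_closed[OF assms(1)]
  unfolding gamma_ideal_def left_ideal_def right_ideal_def fuzzy_ideal_def
    fuzzy_left_ideal_def fuzzy_right_ideal_def level_subset_def
  by (auto intro: order_trans)

text \<open>Each defining inequality \<open>mu z \<ge> mu y\<close> says that \<open>z\<close> lies in the level subset
  at \<open>t = mu y\<close>, which always contains \<open>y\<close>.\<close>

lemma fuzzy_ideal_if_level_subsets:
  assumes "fuzzy_subset M mu"
    and ideal: "\<And>t. t \<in> {0..1} \<Longrightarrow> level_subset M mu t \<noteq> {} \<Longrightarrow>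
      gamma_ideal M G opn r (level_subset M mu t)"
  shows "fuzzy_ideal M G opn r mu"
proof -
  have self: "y \<in> level_subset M mu (mu y)" if "y \<in> M" for y
    using that by (simp add: level_subset_def)
  \<comment> \<open>The threshold \<open>mu y\<close> is admissible: it lies in [0,1] because
    \<open>mu\<close> is a fuzzy subset, and its level contains \<open>y\<close>.\<close>
  have level: "gamma_ideal M G opn r (level_subset M mu (mu y))" if "y \<in> M" for y
    using ideal[of "mu y"] self[OF that] that assms(1) unfolding fuzzy_subset_def by blast
  have mem: "mu y \<le> mu z" if "z \<in> level_subset M mu (mu y)" for y z
    using that by (simp add: level_subset_def)
  have "mu y \<le> mu (opn x g y)" "mu y \<le> mu (opn y g x)" if "x \<in> M" "y \<in> M" "g \<in> G" for x y g
    using level[OF \<open>y \<in> M\<close>] self[OF \<open>y \<in> M\<close>] that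
    by (auto intro!: mem simp: gamma_ideal_def left_ideal_def right_ideal_def)
  moreover have "mu y \<le> mu x" if "x \<in> M" "y \<in> M" "(x, y) \<in> r" for x y
    using level[OF \<open>y \<in> M\<close>] self[OF \<open>y \<in> M\<close>] that
    by (auto intro!: mem simp: gamma_ideal_def left_ideal_def)
  ultimately show ?thesis
    using assms(1) by (simp add: fuzzy_ideal_def fuzzy_left_ideal_def fuzzy_right_ideal_def)
qed

theorem theorem6:
  fixes M :: "'a set" and G :: "'g set"
    and opn :: "'a \<Rightarrow> 'g \<Rightarrow> 'a \<Rightarrow> 'a" and r :: "'a rel" and mu :: "'a \<Rightarrow> real"
  assumes "ordered_gamma_groupoid M G opn r"
    and "fuzzy_subset M mu"
  shows "(fuzzy_ideal M G opn r mu \<longrightarrow>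
           (\<forall>t\<in>{0..1}. level_subset M mu t \<noteq> {} \<longrightarrow> gamma_ideal M G opn r (level_subset M mu t)))
       \<and> ((\<forall>t\<in>{0..1}. gamma_ideal M G opn r (level_subset M mu t)) \<longrightarrow>
           fuzzy_ideal M G opn r mu)"
  using assms(2) fuzzy_ideal_level_subset[OF ordered_gamma_groupoid.axioms(1)[OF assms(1)]]
  \<comment> \<open>The converse lemma asks only about nonempty levels, a special case of the
    hypothesis on all \<open>t\<close>.\<close>
  by (blast intro: fuzzy_ideal_if_level_subsets)

end
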